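(* Let $A$ be the matrix defining the $3\times 4\times 6$ transportation problem, let $Q$ be the semigroup generated by its columns, let $f$ be the vector of right-hand sides and $z^*$ the point specified in the context, and let $A'$ be the matrix formed by the $24$ columns $A_{.,ijk}$ of $A$ for which $z^*_{ijk}>0$. Then the set of holes of $Q$ belonging to $f+Q$ is \[ \{f+A'\lambda' : \lambda'\in\mathbb{Z}_+^{24}\}. \] In particular, $f+Q$ contains infinitely many holes of $Q$.
   Context: Let $\mathbb{Z}_+$ denote the nonnegative integers. The $3\times4\times6$ transportation problem has variables $x_{ijk}$, $1\le i\le 3$, $1\le j\le 4$, $1\le k\le 6$, and constraints $\sum_i x_{ijk}=u_{jk}$, $\sum_j x_{ijk}=v_{ik}$, $\sum_k x_{ijk}=w_{ij}$. $A$ is the $0/1$ matrix with $72$ columns (and $12+18+24=54$ rows) sending $x=(x_{ijk})$ to the vector of all these sums $(w_{ij}),(v_{ik}),(u_{jk})$; $A_{.,ijk}$ is the column corresponding to the variable $x_{ijk}$. $Q=\{A\lambda:\lambda\in\mathbb{Z}_+^{72}\}$, $Q_{\mathrm{sat}}=\{A\lambda:\lambda\in\mathbb{R}^{72},\lambda\ge0\}\cap\{A\lambda:\lambda\in\mathbb{Z}^{72}\}$, and a hole of $Q$ is an element of $H=Q_{\mathrm{sat}}\setminus Q$. The vector $f$ (a hole found by Vlach) is given by three matrices: the $4\times 3$ matrix with rows indexed by $j$ and columns by $i$ of the $w_{ij}$, the $6\times3$ matrix with rows indexed by $k$ and columns by $i$ of the $v_{ik}$, and the $6\times 4$ matrix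 with rows indexed by $k$ and columns by $j$ of the $u_{jk}$, respectively \[ \begin{pmatrix}1&1&1\\1&1&1\\1&1&1\\1&1&1\end{pmatrix},\quad \begin{pmatrix}1&1&0\\1&1&0\\1&0&1\\1&0&1\\0&1&1\\0&1&1\end{pmatrix},\quad \begin{pmatrix}1&0&0&1\\0&1&1&0\\1&1&0&0\\0&0&1&1\\1&0&1&0\\0&1&0&1\end{pmatrix}. \] The point $z^*$ is the unique point of the polytope $\{z\in\mathbb{R}^{72}:Az=f,\ z\ge0\}$. Written as six $4\times3$ blocks for $k=1,\dots,6$ (rows indexed by $j$, columns by $i$), it is $\tfrac12$ times \[ \begin{pmatrix}1&1&0\\0&0&0\\0&0&0\\1&1&0\end{pmatrix}, \begin{pmatrix}0&0&0\\1&1&0\\1&1&0\\0&0&0\end{pmatrix}, \begin{pmatrix}1&0&1\\1&0&1\\0&0&0\\0&0&0\end{pmatrix}, \begin{pmatrix}0&0&0\\0&0&0\\1&0&1\\1&0&1\end{pmatrix}, \begin{pmatrix}0&1&1\\0&0&0\\0&1&1\\0&0&0\end{pmatrix}, \begin{pmatrix}0&0&0\\0&1&1\\0&0&0\\0&1&1\end{pmatrix}. \] *)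

theory Defs
  imports "HOL-Analysis.Analysis"
begin

definition semigroup_of :: "real^'n^'m \<Rightarrow> (real^'m) set" where
  "semigroup_of M = {M *v l | l. \<forall>c. l $ c \<in> \<nat>}"

definition saturation_of :: "real^'n^'m \<Rightarrow> (real^'m) set" where
  "saturation_of M = {M *v l | l. \<forall>c. 0 \<le> l $ c} \<inter> {M *v l | l. \<forall>c. l $ c \<in> \<int>}"

definition holes_of :: "real^'n^'m \<Rightarrow> (real^'m) set" where
  "holes_of M = saturation_of M - semigroup_of M"

text \<open>The index ranges are the numeral types \<^typ>\<open>3\<close>, \<^typ>\<open>4\<close>, \<^typ>\<open>6\<close>, with the indices
  written \<open>1, \<dots>, n\<close> (where \<open>n = 0\<close> in the type \<open>n\<close>); this is also the numbering that
  \<^const>\<open>vector\<close> uses for the entries of a list. A variable index is a triple \<open>(i, j, k)\<close>;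
  a constraint index is a pair \<open>(i, j)\<close>, \<open>(i, k)\<close> or \<open>(j, k)\<close>, for the sums
  \<open>w i j\<close>, \<open>v i k\<close>, \<open>u j k\<close> respectively.\<close>

type_synonym var_idx = "3 \<times> 4 \<times> 6"
type_synonym con_idx = "3 \<times> 4 + 3 \<times> 6 + 4 \<times> 6"

abbreviation w_row :: "3 \<Rightarrow> 4 \<Rightarrow> con_idx" where "w_row i j \<equiv> Inl (i, j)"
abbreviation v_row :: "3 \<Rightarrow> 6 \<Rightarrow> con_idx" where "v_row i k \<equiv> Inr (Inl (i, k))"
abbreviation u_row :: "4 \<Rightarrow> 6 \<Rightarrow> con_idx" where "u_row j k \<equiv> Inr (Inr (j, k))"

definition transport_mat :: "real^var_idx^con_idx" where
  "transport_mat = (\<chi> r c. case c of (i, j, k) \<Rightarrow>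
     of_bool (r = w_row i j \<or> r = v_row i k \<or> r = u_row j k))"

lemma sum_UNIV_triple:
  fixes g :: "'a::finite \<times> 'b::finite \<times> 'c::finite \<Rightarrow> real"
  shows "(\<Sum>c\<in>UNIV. g c) = (\<Sum>i\<in>UNIV. \<Sum>j\<in>UNIV. \<Sum>k\<in>UNIV. g (i, j, k))"
  by (simp add: sum.cartesian_product flip: UNIV_Times_UNIV)

lemma transport_mat_mult:
  "(transport_mat *v x) $ w_row i j = (\<Sum>k\<in>UNIV. x $ (i, j, k))"
  "(transport_mat *v x) $ v_row i k = (\<Sum>j\<in>UNIV. x $ (i, j, k))"
  "(transport_mat *v x) $ u_row j k = (\<Sum>i\<in>UNIV. x $ (i, j, k))"
proof -
  have sum_pull: "(\<Sum>k\<in>K. of_bool P * g k) = of_bool P * (\<Sum>k\<in>K. g k :: real)"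
    for P g and K :: "'z set"
    by (simp only: sum_distrib_left)
  have sum_one: "(\<Sum>k\<in>UNIV. of_bool (a = k) * g k) = (g a :: real)" for a :: "'z::finite" and g
    by (simp add: of_bool_def if_distrib[of "\<lambda>y. y * _"] cong: if_cong)
  show "(transport_mat *v x) $ w_row i j = (\<Sum>k\<in>UNIV. x $ (i, j, k))"
    "(transport_mat *v x) $ v_row i k = (\<Sum>j\<in>UNIV. x $ (i, j, k))"
    "(transport_mat *v x) $ u_row j k = (\<Sum>i\<in>UNIV. x $ (i, j, k))"
    unfolding matrix_vector_mult_def transport_mat_def sum_UNIV_triple
    by (simp_all only: vec_lambda_beta prod.case sum.inject sum.distinct prod.inject
        HOL.simp_thms of_bool_conj mult.assoc sum_pull sum_one)
qed

text \<open>The margins of Vlach's hole, displayed with rows indexed by \<open>j\<close>, \<open>k\<close>, \<open>k\<close> and columns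
  by \<open>i\<close>, \<open>i\<close>, \<open>j\<close>.\<close>

definition w_margin :: "real^3^4" where
  "w_margin = vector
     [vector [1,1,1],
      vector [1,1,1],
      vector [1,1,1],
      vector [1,1,1]]"

definition v_margin :: "real^3^6" where
  "v_margin = vector
     [vector [1,1,0],
      vector [1,1,0],
      vector [1,0,1],
      vector [1,0,1],
      vector [0,1,1],
      vector [0,1,1]]"

definition u_margin :: "real^4^6" where
  "u_margin = vector
     [vector [1,0,0,1],
      vector [0,1,1,0],
      vector [1,1,0,0],
      vector [0,0,1,1],
      vector [1,0,1,0],
      vector [0,1,0,1]]"

definition vlach_hole :: "real^con_idx" where
  "vlach_hole = (\<chi> r. case r of
      Inl (i, j) \<Rightarrow> w_margin $ j $ i
    | Inr (Inl (i, k)) \<Rightarrow> v_margin $ k $ i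
    | Inr (Inr (j, k)) \<Rightarrow> u_margin $ k $ j)"

text \<open>Six blocks, one for each \<open>k\<close>, with rows indexed by \<open>j\<close> and columns by \<open>i\<close>.\<close>

definition z_blocks :: "real^3^4^6" where
  "z_blocks = vector
     [vector [vector [1,1,0], vector [0,0,0], vector [0,0,0], vector [1,1,0]],
      vector [vector [0,0,0], vector [1,1,0], vector [1,1,0], vector [0,0,0]],
      vector [vector [1,0,1], vector [1,0,1], vector [0,0,0], vector [0,0,0]],
      vector [vector [0,0,0], vector [0,0,0], vector [1,0,1], vector [1,0,1]],
      vector [vector [0,1,1], vector [0,0,0], vector [0,1,1], vector [0,0,0]],
      vector [vector [0,0,0], vector [0,1,1], vector [0,0,0], vector [0,1,1]]]"

definition z_star :: "real^var_idx" where
  "z_star = (\<chi> c. case c of (i, j, k) \<Rightarrow> (1/2) * z_blocks $ k $ j $ i)"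

lemma UNIV_6: "(UNIV :: 6 set) = {1, 2, 3, 4, 5, 6}"
proof -
  have "card {1, 2, 3, 4, 5, 6 :: 6} = CARD(6)" by simp
  then show "(UNIV :: 6 set) = {1, 2, 3, 4, 5, 6}"
    by (intro card_subset_eq[symmetric]) auto
qed

lemma vector_4:
  "(vector [a, b, c, d] :: 'a::zero^4) $ 1 = a"
  "(vector [a, b, c, d] :: 'a::zero^4) $ 2 = b"
  "(vector [a, b, c, d] :: 'a::zero^4) $ 3 = c"
  "(vector [a, b, c, d] :: 'a::zero^4) $ 4 = d"
  unfolding vector_def by simp_all

lemma vector_6:
  "(vector [a, b, c, d, e, g] :: 'a::zero^6) $ 1 = a"
  "(vector [a, b, c, d, e, g] :: 'a::zero^6) $ 2 = b"
  "(vector [a, b, c, d, e, g] :: 'a::zero^6) $ 3 = c"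
  "(vector [a, b, c, d, e, g] :: 'a::zero^6) $ 4 = d"
  "(vector [a, b, c, d, e, g] :: 'a::zero^6) $ 5 = e"
  "(vector [a, b, c, d, e, g] :: 'a::zero^6) $ 6 = g"
  unfolding vector_def by simp_all

lemma sum_6: "sum g (UNIV :: 6 set) = g 1 + g 2 + g 3 + g 4 + g 5 + g 6"
  unfolding UNIV_6 by (simp add: ac_simps)

lemma forall_6: "(\<forall>k::6. P k) \<longleftrightarrow> P 1 \<and> P 2 \<and> P 3 \<and> P 4 \<and> P 5 \<and> P 6"
proof -
  have "(\<forall>k::6. P k) \<longleftrightarrow> (\<forall>k\<in>UNIV. P k)" by simp
  also have "\<dots> \<longleftrightarrow> P 1 \<and> P 2 \<and> P 3 \<and> P 4 \<and> P 5 \<and> P 6"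
    unfolding UNIV_6 by (simp only: ball_simps HOL.simp_thms)
  finally show ?thesis .
qed

lemma z_blocks_nth:
  "z_blocks $ 1 = vector [vector [1,1,0], vector [0,0,0], vector [0,0,0], vector [1,1,0]]"
  "z_blocks $ 2 = vector [vector [0,0,0], vector [1,1,0], vector [1,1,0], vector [0,0,0]]"
  "z_blocks $ 3 = vector [vector [1,0,1], vector [1,0,1], vector [0,0,0], vector [0,0,0]]"
  "z_blocks $ 4 = vector [vector [0,0,0], vector [0,0,0], vector [1,0,1], vector [1,0,1]]"
  "z_blocks $ 5 = vector [vector [0,1,1], vector [0,0,0], vector [0,1,1], vector [0,0,0]]"
  "z_blocks $ 6 = vector [vector [0,0,0], vector [0,1,1], vector [0,0,0], vector [0,1,1]]"
  unfolding z_blocks_def by (simp_all only: vector_6)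

lemma w_margin_nth:
  "w_margin $ 1 = vector [1,1,1]"
  "w_margin $ 2 = vector [1,1,1]"
  "w_margin $ 3 = vector [1,1,1]"
  "w_margin $ 4 = vector [1,1,1]"
  unfolding w_margin_def by (simp_all only: vector_4)

lemma v_margin_nth:
  "v_margin $ 1 = vector [1,1,0]"
  "v_margin $ 2 = vector [1,1,0]"
  "v_margin $ 3 = vector [1,0,1]"
  "v_margin $ 4 = vector [1,0,1]"
  "v_margin $ 5 = vector [0,1,1]"
  "v_margin $ 6 = vector [0,1,1]"
  unfolding v_margin_def by (simp_all only: vector_6)

lemma u_margin_nth:
  "u_margin $ 1 = vector [1,0,0,1]"
  "u_margin $ 2 = vector [0,1,1,0]"
  "u_margin $ 3 = vector [1,1,0,0]"
  "u_margin $ 4 = vector [0,0,1,1]"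
  "u_margin $ 5 = vector [1,0,1,0]"
  "u_margin $ 6 = vector [0,1,0,1]"
  unfolding u_margin_def by (simp_all only: vector_6)

text \<open>The columns of \<^const>\<open>transport_mat\<close> that make up the submatrix \<open>A'\<close> are indexed by the
  support of \<^const>\<open>z_star\<close>, which has 24 elements.\<close>

typedef supp_idx = "{c :: var_idx. 0 < z_star $ c}"
proof
  show "(1, 1, 1) \<in> {c :: var_idx. 0 < z_star $ c}"
    by (simp add: z_star_def z_blocks_nth vector_4)
qed

instance supp_idx :: finite
  by standard
    (metis finite_imageD finite inj_on_def Rep_supp_idx_inject)

definition transport_submat :: "real^supp_idx^con_idx" where
  "transport_submat = (\<chi> r c. transport_mat $ r $ Rep_supp_idx c)"

lemma card_supp_idx: "CARD(supp_idx) = 24"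
proof -
  have "CARD(supp_idx) = card {c :: var_idx. 0 < z_star $ c}"
    using type_definition.card[OF type_definition_supp_idx] .
  also have "real \<dots> = (\<Sum>c\<in>UNIV. of_bool (0 < z_star $ c))"
    by simp
  also have "\<dots> = 24"
    by (simp add: sum_UNIV_triple sum_3 sum_4 sum_6 z_star_def z_blocks_nth vector_4)
  finally show ?thesis by simp
qed

lemma transport_mat_z_star: "transport_mat *v z_star = vlach_hole"
proof -
  have "\<forall>i j. (transport_mat *v z_star) $ w_row i j = vlach_hole $ w_row i j"
    by (simp add: transport_mat_mult vlach_hole_def z_star_def forall_3 forall_4 sum_6
        w_margin_nth z_blocks_nth vector_4)
  moreover have "\<forall>i k. (transport_mat *v z_star) $ v_row i k = vlach_hole $ v_row i k"
    by (simp add: transport_mat_mult vlach_hole_def z_star_def forall_3 forall_6 sum_4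
        v_margin_nth z_blocks_nth vector_4)
  moreover have "\<forall>j k. (transport_mat *v z_star) $ u_row j k = vlach_hole $ u_row j k"
    by (simp add: transport_mat_mult vlach_hole_def z_star_def forall_4 forall_6 sum_3
        u_margin_nth z_blocks_nth vector_4)
  ultimately show ?thesis
    by (simp add: vec_eq_iff split_sum_all)
qed

end

theory Submission
  imports Defs
begin

text \<open>The support of \<^const>\<open>z_star\<close> consists of the variables that are not forced to vanish by a
  zero margin of \<open>f\<close>. If \<open>A \<mu> = f + A \<lambda>\<close> with \<open>\<mu>\<close>, \<open>\<lambda>\<close> natural and \<open>\<lambda>\<close> supported there, then so is
  \<open>\<mu>\<close>, and \<open>d = \<mu> - \<lambda>\<close> satisfies \<open>A d = f\<close>. Every equation of this system with right-hand side 1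
  involves exactly two variables of the support, and an odd cycle of such equations gives
  \<open>2 * d $ (1, 1, 1) = 1\<close>, which is impossible for integers. Conversely, for each of the 48 columns \<open>c\<close>
  outside the support, \<open>f + A_c\<close> has a natural solution. Identifying \<open>k\<close> with the edges of \<open>K\<^sub>4\<close>
  (the rows of \<^const>\<open>u_margin\<close>) and \<open>i\<close> with its perfect matchings, \<open>f\<close> is invariant under the
  symmetric group of the vertices \<open>j\<close>, so that a few explicit tables suffice.\<close>

section \<open>Tables with margins \<open>f\<close> and a single negative entry\<close>

text \<open>The vector \<open>x\<close> is a natural solution for \<open>f\<close> plus column \<open>c\<close>, with that column subtracted again.\<close>

definition fillable :: "var_idx \<Rightarrow> bool" where
  "fillable c \<longleftrightarrow> (\<exists>x. (\<forall>d. x $ d + of_bool (d = c) \<in> \<nat>) \<and> transport_mat *v x = vlach_hole)"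

lemma con_vec_eq_iff:
  fixes a b :: "real^con_idx"
  shows "a = b \<longleftrightarrow> (\<forall>i j. a $ w_row i j = b $ w_row i j) \<and>
    (\<forall>i k. a $ v_row i k = b $ v_row i k) \<and> (\<forall>j k. a $ u_row j k = b $ u_row j k)"
  by (simp add: vec_eq_iff split_sum_all)

lemma fillable_blocksI:
  fixes b :: "real^3^4^6"
  assumes "\<forall>i j k. b $ k $ j $ i + of_bool (i = a \<and> j = a' \<and> k = a'') \<in> \<nat>"
    and "\<forall>i j. (\<Sum>k\<in>UNIV. b $ k $ j $ i) = vlach_hole $ w_row i j"
    and "\<forall>i k. (\<Sum>j\<in>UNIV. b $ k $ j $ i) = vlach_hole $ v_row i k"
    and "\<forall>j k. (\<Sum>i\<in>UNIV. b $ k $ j $ i) = vlach_hole $ u_row j k"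
  shows "fillable (a, a', a'')"
  unfolding fillable_def
  by (rule exI[of _ "\<chi> c. case c of (i, j, k) \<Rightarrow> b $ k $ j $ i"])
    (use assms in \<open>simp add: con_vec_eq_iff transport_mat_mult\<close>)

text \<open>This table and the next three have one entry -1, at the named cell, and entries 0 or 1
  elsewhere. The four cells represent the rotation orbits in \<open>fillable_off_support\<close>.
  The present table is also the integer solution of \<open>f\<close> used in
  \<open>vlach_plus_in_saturation\<close>.\<close>

lemma fillable_311: "fillable (3, 1, 1)"
  by (rule fillable_blocksI[of "vector
     [vector [vector [1,1,-1], vector [0,0,0], vector [0,0,0], vector [0,0,1]],
      vector [vector [0,0,0], vector [0,1,0], vector [1,0,0], vector [0,0,0]],
      vector [vector [0,0,1], vector [1,0,0], vector [0,0,0], vector [0,0,0]],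
      vector [vector [0,0,0], vector [0,0,0], vector [0,0,1], vector [1,0,0]],
      vector [vector [0,0,1], vector [0,0,0], vector [0,1,0], vector [0,0,0]],
      vector [vector [0,0,0], vector [0,0,1], vector [0,0,0], vector [0,1,0]]]"])
    (simp_all add: vlach_hole_def forall_3 forall_4 forall_6 sum_3 sum_4 sum_6
      w_margin_nth v_margin_nth u_margin_nth vector_4 vector_6)

lemma fillable_112: "fillable (1, 1, 2)"
  by (rule fillable_blocksI[of "vector
     [vector [vector [1,0,0], vector [0,0,0], vector [0,0,0], vector [0,1,0]],
      vector [vector [-1,1,0], vector [1,0,0], vector [1,0,0], vector [0,0,0]],
      vector [vector [1,0,0], vector [0,0,1], vector [0,0,0], vector [0,0,0]],
      vector [vector [0,0,0], vector [0,0,0], vector [0,0,1], vector [1,0,0]],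
      vector [vector [0,0,1], vector [0,0,0], vector [0,1,0], vector [0,0,0]],
      vector [vector [0,0,0], vector [0,1,0], vector [0,0,0], vector [0,0,1]]]"])
    (simp_all add: vlach_hole_def forall_3 forall_4 forall_6 sum_3 sum_4 sum_6
      w_margin_nth v_margin_nth u_margin_nth vector_4 vector_6)

lemma fillable_212: "fillable (2, 1, 2)"
  by (rule fillable_blocksI[of "vector
     [vector [vector [0,1,0], vector [0,0,0], vector [0,0,0], vector [1,0,0]],
      vector [vector [1,-1,0], vector [0,1,0], vector [0,1,0], vector [0,0,0]],
      vector [vector [0,0,1], vector [1,0,0], vector [0,0,0], vector [0,0,0]],
      vector [vector [0,0,0], vector [0,0,0], vector [1,0,0], vector [0,0,1]],
      vector [vector [0,1,0], vector [0,0,0], vector [0,0,1], vector [0,0,0]],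
      vector [vector [0,0,0], vector [0,0,1], vector [0,0,0], vector [0,1,0]]]"])
    (simp_all add: vlach_hole_def forall_3 forall_4 forall_6 sum_3 sum_4 sum_6
      w_margin_nth v_margin_nth u_margin_nth vector_4 vector_6)

lemma fillable_312: "fillable (3, 1, 2)"
  by (rule fillable_blocksI[of "vector
     [vector [vector [1,0,0], vector [0,0,0], vector [0,0,0], vector [0,1,0]],
      vector [vector [0,1,-1], vector [0,0,1], vector [1,0,0], vector [0,0,0]],
      vector [vector [0,0,1], vector [1,0,0], vector [0,0,0], vector [0,0,0]],
      vector [vector [0,0,0], vector [0,0,0], vector [0,0,1], vector [1,0,0]],
      vector [vector [0,0,1], vector [0,0,0], vector [0,1,0], vector [0,0,0]],
      vector [vector [0,0,0], vector [0,1,0], vector [0,0,0], vector [0,0,1]]]"])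
    (simp_all add: vlach_hole_def forall_3 forall_4 forall_6 sum_3 sum_4 sum_6
      w_margin_nth v_margin_nth u_margin_nth vector_4 vector_6)

lemma Nats_nonneg: "a \<in> \<nat> \<Longrightarrow> 0 \<le> (a::real)"
  by (auto elim: Nats_cases)

section \<open>Symmetries of \<open>f\<close> and the columns outside the support\<close>

text \<open>Pulling a table back along bijections that preserve the margins only reorders its line
  sums, and the pullback moves the exceptional cell from \<open>(p i, q j, r k)\<close> to
  \<open>(i, j, k)\<close>.\<close>

lemma fillable_permute:
  assumes "bij p" "bij q" "bij r"
    and w: "\<forall>i j. vlach_hole $ w_row (p i) (q j) = vlach_hole $ w_row i j"
    and v: "\<forall>i k. vlach_hole $ v_row (p i) (r k) = vlach_hole $ v_row i k"
    and u: "\<forall>j k. vlach_hole $ u_row (q j) (r k) = vlach_hole $ u_row j k"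
    and "fillable (p i, q j, r k)"
  shows "fillable (i, j, k)"
proof -
  obtain x where nat: "\<And>d. x $ d + of_bool (d = (p i, q j, r k)) \<in> \<nat>"
    and x: "transport_mat *v x = vlach_hole"
    using assms(7) unfolding fillable_def by blast
  define y :: "real^var_idx" where "y = (\<chi> d. case d of (a, b, c) \<Rightarrow> x $ (p a, q b, r c))"
  have y_nth: "y $ (a, b, c) = x $ (p a, q b, r c)" for a b c
    by (simp add: y_def)
  have "\<forall>d. y $ d + of_bool (d = (i, j, k)) \<in> \<nat>"
  proof
    fix d :: var_idx
    obtain a b c where d: "d = (a, b, c)" by (cases d) auto
    have "d = (i, j, k) \<longleftrightarrow> (p a, q b, r c) = (p i, q j, r k)"
      using assms(1-3) by (auto simp: d bij_def inj_eq)
    then show "y $ d + of_bool (d = (i, j, k)) \<in> \<nat>"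
      using nat[of "(p a, q b, r c)"] by (simp add: y_nth d)
  qed
  moreover have "transport_mat *v y = vlach_hole"
  proof -
    have "(\<Sum>c\<in>UNIV. x $ (p a, q b, r c)) = vlach_hole $ w_row a b" for a b
      using sum.reindex_bij_betw[OF assms(3), of "\<lambda>c. x $ (p a, q b, c)"] w
      by (simp add: x flip: transport_mat_mult)
    moreover have "(\<Sum>b\<in>UNIV. x $ (p a, q b, r c)) = vlach_hole $ v_row a c" for a c
      using sum.reindex_bij_betw[OF assms(2), of "\<lambda>b. x $ (p a, b, r c)"] v
      by (simp add: x flip: transport_mat_mult)
    moreover have "(\<Sum>a\<in>UNIV. x $ (p a, q b, r c)) = vlach_hole $ u_row b c" for b c
      using sum.reindex_bij_betw[OF assms(1), of "\<lambda>a. x $ (a, q b, r c)"] u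
      by (simp add: x flip: transport_mat_mult)
    ultimately show ?thesis
      by (simp add: con_vec_eq_iff transport_mat_mult y_nth)
  qed
  ultimately show ?thesis
    unfolding fillable_def by blast
qed

text \<open>All \<open>w\<close> margins are 1, so only \<open>v\<close> and \<open>u\<close> can
  force a zero. In the graph picture, a support cell has vertex j on edge k and edge k outside
  matching i.\<close>

lemma z_star_pos_iff:
  "0 < z_star $ (i, j, k) \<longleftrightarrow>
    vlach_hole $ v_row i k \<noteq> 0 \<and> vlach_hole $ u_row j k \<noteq> 0"
proof -
  have "\<forall>i j k. 0 < z_star $ (i, j, k) \<longleftrightarrow>
      vlach_hole $ v_row i k \<noteq> 0 \<and> vlach_hole $ u_row j k \<noteq> 0"
    by (simp add: forall_3 forall_4 forall_6 z_star_def vlach_hole_def z_blocks_nth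
        v_margin_nth u_margin_nth vector_4)
  then show ?thesis by blast
qed

abbreviation swap :: "'a \<Rightarrow> 'a \<Rightarrow> 'a \<Rightarrow> 'a" where
  "swap \<equiv> Transposition.transpose"

text \<open>The twelve off-support cells with j = 1 form four orbits of size three under the
  rotation fixing vertex 1, and the Klein four-group carries every other vertex to 1.\<close>

lemma fillable_off_support:
  assumes "\<not> 0 < z_star $ c"
  shows "fillable c"
proof -
  note margins = vlach_hole_def forall_3 forall_4 forall_6 w_margin_nth v_margin_nth u_margin_nth
    vector_4 Transposition.transpose_def
  \<comment> \<open>The vertex permutation \<open>2 \<rightarrow> 3 \<rightarrow> 4 \<rightarrow> 2\<close> and two generators of the Klein four-group, each with
    its action on edges and matchings\<close>
  let ?ri = "swap 1 2 \<circ> swap 1 3 :: 3 \<Rightarrow> 3"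
  let ?rj = "swap 2 3 \<circ> swap 3 4 :: 4 \<Rightarrow> 4"
  let ?rk = "swap 1 3 \<circ> swap 3 5 \<circ> (swap 2 4 \<circ> swap 4 6) :: 6 \<Rightarrow> 6"
  let ?aj = "swap 1 2 \<circ> swap 3 4 :: 4 \<Rightarrow> 4"
  let ?ak = "swap 1 2 \<circ> swap 5 6 :: 6 \<Rightarrow> 6"
  let ?bj = "swap 1 3 \<circ> swap 2 4 :: 4 \<Rightarrow> 4"
  let ?bk = "swap 1 2 \<circ> swap 3 4 :: 6 \<Rightarrow> 6"
  have rot: "fillable (i, j, k)" if "fillable (?ri i, ?rj j, ?rk k)" for i j k
    by (rule fillable_permute[of ?ri ?rj ?rk, OF _ _ _ _ _ _ that]) (simp_all add: bij_comp margins)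
  have flip1: "fillable (i, j, k)" if "fillable (id i, ?aj j, ?ak k)" for i j k
    by (rule fillable_permute[of id ?aj ?ak, OF _ _ _ _ _ _ that]) (simp_all add: bij_comp margins)
  have flip2: "fillable (i, j, k)" if "fillable (id i, ?bj j, ?bk k)" for i j k
    by (rule fillable_permute[of id ?bj ?bk, OF _ _ _ _ _ _ that]) (simp_all add: bij_comp margins)
  note fill_1 = fillable_311 fillable_112 fillable_212 fillable_312
  \<comment> \<open>Rotation preimages of the four base cells; \<open>fill_3\<close> takes preimages
    once more, which completes the twelve cells.\<close>
  have fill_2: "fillable (1, 1, 5)" "fillable (2, 1, 6)" "fillable (3, 1, 6)" "fillable (1, 1, 6)"
    by (rule rot; simp add: Transposition.transpose_def fill_1)+
  have fill_3: "fillable (2, 1, 3)" "fillable (3, 1, 4)" "fillable (1, 1, 4)" "fillable (2, 1, 4)"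
    by (rule rot; simp add: Transposition.transpose_def fill_2)+
  have j1: "\<forall>i k. \<not> 0 < z_star $ (i, 1, k) \<longrightarrow> fillable (i, 1, k)"
    by (simp add: forall_3 forall_6 z_star_def z_blocks_nth vector_4 fill_1 fill_2 fill_3)
  \<comment> \<open>Invariance of \<open>z_star\<close> guarantees that a cell off the support is
    moved to a cell off the support, where the case already settled applies.\<close>
  have z_flip1: "z_star $ (i, ?aj j, ?ak k) = z_star $ (i, j, k)" for i j k
  proof -
    have "\<forall>i j k. z_star $ (i, ?aj j, ?ak k) = z_star $ (i, j, k)"
      by (simp add: forall_3 forall_4 forall_6 z_star_def z_blocks_nth vector_4
          Transposition.transpose_def)
    then show ?thesis by blast
  qed
  have z_flip2: "z_star $ (i, ?bj j, ?bk k) = z_star $ (i, j, k)" for i j k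
  proof -
    have "\<forall>i j k. z_star $ (i, ?bj j, ?bk k) = z_star $ (i, j, k)"
      by (simp add: forall_3 forall_4 forall_6 z_star_def z_blocks_nth vector_4
          Transposition.transpose_def)
    then show ?thesis by blast
  qed
  have j2: "fillable (i, 2, k)" if "\<not> 0 < z_star $ (i, 2, k)" for i k
  proof (rule flip1)
    have "?aj 2 = 1"
      by (simp add: Transposition.transpose_def)
    then show "fillable (id i, ?aj 2, ?ak k)"
      using j1 that z_flip1[of i 2 k] unfolding id_apply by metis
  qed
  have "fillable (i, j, k)" if "j = 3 \<or> j = 4" "\<not> 0 < z_star $ (i, j, k)" for i j k
  proof (rule flip2)
    have "?bj j = 1 \<or> ?bj j = 2"
      using that(1) by (auto simp: Transposition.transpose_def)
    then show "fillable (id i, ?bj j, ?bk k)"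
      using j1 j2 that(2) z_flip2[of i j k] unfolding id_apply by metis
  qed
  with j1 j2 have "\<forall>j i k. \<not> 0 < z_star $ (i, j, k) \<longrightarrow> fillable (i, j, k)"
    by (simp add: forall_4)
  with assms show ?thesis
    by (cases c) blast
qed

section \<open>The submatrix A' as a restriction of A to the support\<close>

lemma transport_submat_mult:
  assumes "\<forall>c. \<not> 0 < z_star $ c \<longrightarrow> x $ c = 0"
  shows "transport_submat *v (\<chi> c. x $ Rep_supp_idx c) = transport_mat *v x"
proof -
  have "(\<Sum>c\<in>UNIV. transport_mat $ r $ Rep_supp_idx c * x $ Rep_supp_idx c)
      = (\<Sum>c\<in>UNIV. transport_mat $ r $ c * x $ c)" for r
  proof -
    have "(\<Sum>c\<in>UNIV. transport_mat $ r $ Rep_supp_idx c * x $ Rep_supp_idx c)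
        = (\<Sum>c\<in>range Rep_supp_idx. transport_mat $ r $ c * x $ c)"
      by (subst sum.reindex) (auto simp: inj_on_def Rep_supp_idx_inject)
    also have "\<dots> = (\<Sum>c\<in>UNIV. transport_mat $ r $ c * x $ c)"
      using assms
      by (intro sum.mono_neutral_left)
        (auto simp: type_definition.Rep_range[OF type_definition_supp_idx])
    finally show ?thesis .
  qed
  then show ?thesis
    by (simp add: vec_eq_iff matrix_vector_mult_def transport_submat_def)
qed

text \<open>Extension by zero and restriction identify the coefficient vectors of A' with those of A
  supported on \<open>z_star\<close>, so the rest of the argument can use A alone.\<close>

lemma submat_semigroup_eq:
  "{vlach_hole + transport_submat *v l | l. \<forall>c. l $ c \<in> \<nat>} =
    {vlach_hole + transport_mat *v x | x. (\<forall>c. x $ c \<in> \<nat>) \<and> (\<forall>c. \<not> 0 < z_star $ c \<longrightarrow> x $ c = 0)}"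
  (is "?L = ?R")
proof
  show "?L \<subseteq> ?R"
  proof
    fix h assume "h \<in> ?L"
    then obtain l where l: "\<forall>c. l $ c \<in> \<nat>" and h: "h = vlach_hole + transport_submat *v l"
      by blast
    \<comment> \<open>The guard is needed because \<open>Abs_supp_idx\<close> is unspecified off the
      support.\<close>
    define x :: "real^var_idx" where "x = (\<chi> c. if 0 < z_star $ c then l $ Abs_supp_idx c else 0)"
    have "(\<chi> c. x $ Rep_supp_idx c) = l"
      using Rep_supp_idx by (simp add: x_def vec_eq_iff Rep_supp_idx_inverse)
    moreover have "\<forall>c. \<not> 0 < z_star $ c \<longrightarrow> x $ c = 0" "\<forall>c. x $ c \<in> \<nat>"
      using l by (simp_all add: x_def)
    ultimately show "h \<in> ?R"
      using transport_submat_mult[of x] h by auto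
  qed
  show "?R \<subseteq> ?L"
  proof
    fix h assume "h \<in> ?R"
    then obtain x where "\<forall>c. x $ c \<in> \<nat>" "\<forall>c. \<not> 0 < z_star $ c \<longrightarrow> x $ c = 0"
      "h = vlach_hole + transport_mat *v x"
      by blast
    then show "h \<in> ?L"
      using transport_submat_mult[of x]
      by (intro CollectI exI[of _ "\<chi> c. x $ Rep_supp_idx c"]) (simp del: split_paired_All)
  qed
qed

section \<open>Supported translates of \<open>f\<close> are not in Q\<close>

text \<open>Neighbours on the cycle sum to 1, so the values alternate between t and 1 - t; after
  nine steps t = 1 - t. No sign condition enters, so this applies to a difference of two natural
  vectors.\<close>

lemma half_on_odd_cycle:
  assumes off: "\<forall>c. \<not> 0 < z_star $ c \<longrightarrow> d $ c = 0"
    and d: "transport_mat *v d = vlach_hole"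
  shows "2 * d $ (1, 1, 1) = 1"
proof -
  have "(\<Sum>i\<in>UNIV. d $ (i, j, k)) = vlach_hole $ u_row j k"
    "(\<Sum>j\<in>UNIV. d $ (i, j, k)) = vlach_hole $ v_row i k"
    "(\<Sum>k\<in>UNIV. d $ (i, j, k)) = vlach_hole $ w_row i j" for i j k
    by (simp_all add: d flip: transport_mat_mult)
  \<comment> \<open>The closed walk is \<open>111, 211, 215, 235, 232, 132, 122, 123, 113, 111\<close>.\<close>
  note rows = this(1)[of 1 1] this(1)[of 3 2] this(2)[of 2 5] this(2)[of 1 2] this(2)[of 1 3]
    this(3)[of 2 1] this(3)[of 2 3] this(3)[of 1 2] this(3)[of 1 1]
  have zero: "d $ (i, j, k) = 0" if "z_star $ (i, j, k) = 0" for i j k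
    using off that by simp
  show ?thesis
    using rows
    by (simp add: sum_3 sum_4 sum_6 vlach_hole_def w_margin_nth v_margin_nth u_margin_nth vector_4
        zero z_star_def z_blocks_nth)
qed

text \<open>A zero margin of \<open>f\<close> through \<open>c\<close> involves only off-support
  variables, where \<open>x\<close> vanishes. The corresponding entries of \<open>m\<close> are
  nonnegative with sum 0.\<close>

lemma vlach_face:
  assumes "\<forall>c. m $ c \<in> \<nat>" "\<forall>c. \<not> 0 < z_star $ c \<longrightarrow> x $ c = 0"
    and eq: "transport_mat *v m = vlach_hole + transport_mat *v x"
    and "\<not> 0 < z_star $ c"
  shows "m $ c = 0"
proof -
  have m0: "0 \<le> m $ c" for c
    using assms(1) by (blast intro: Nats_nonneg)
  obtain i j k where c: "c = (i, j, k)" by (cases c) auto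
  have "vlach_hole $ v_row i k = 0 \<or> vlach_hole $ u_row j k = 0"
    using assms(4) by (simp add: c z_star_pos_iff)
  then show ?thesis
  proof
    assume *: "vlach_hole $ v_row i k = 0"
    then have "(\<Sum>j\<in>UNIV. x $ (i, j, k)) = 0"
      using assms(2) by (simp add: z_star_pos_iff)
    then have "(\<Sum>j\<in>UNIV. m $ (i, j, k)) = 0"
      using arg_cong[OF eq, of "\<lambda>h. h $ v_row i k"] * by (simp add: transport_mat_mult)
    then show ?thesis
      using m0 by (simp add: sum_nonneg_eq_0_iff c)
  next
    assume *: "vlach_hole $ u_row j k = 0"
    then have "(\<Sum>i\<in>UNIV. x $ (i, j, k)) = 0"
      using assms(2) by (simp add: z_star_pos_iff)
    then have "(\<Sum>i\<in>UNIV. m $ (i, j, k)) = 0"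
      using arg_cong[OF eq, of "\<lambda>h. h $ u_row j k"] * by (simp add: transport_mat_mult)
    then show ?thesis
      using m0 by (simp add: sum_nonneg_eq_0_iff c)
  qed
qed

lemma supported_not_in_semigroup:
  assumes nat: "\<forall>c. x $ c \<in> \<nat>" and off: "\<forall>c. \<not> 0 < z_star $ c \<longrightarrow> x $ c = 0"
  shows "vlach_hole + transport_mat *v x \<notin> semigroup_of transport_mat"
proof
  assume "vlach_hole + transport_mat *v x \<in> semigroup_of transport_mat"
  then obtain m where m: "\<forall>c. m $ c \<in> \<nat>"
    and eq: "transport_mat *v m = vlach_hole + transport_mat *v x"
    unfolding semigroup_of_def by force
  have "2 * (m - x) $ (1, 1, 1) = 1"
  proof (rule half_on_odd_cycle)
    show "\<forall>c. \<not> 0 < z_star $ c \<longrightarrow> (m - x) $ c = 0"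
      using vlach_face[OF m off eq] off by simp
    show "transport_mat *v (m - x) = vlach_hole"
      by (simp add: matrix_vector_mult_diff_distrib eq)
  qed
  moreover have "(m - x) $ (1, 1, 1) \<in> \<int>"
    unfolding vector_minus_component using m nat Nats_subset_Ints by (blast intro: Ints_diff)
  then obtain n where "(m - x) $ (1, 1, 1) = of_int n"
    by (auto elim: Ints_cases)
  ultimately have "of_int (2 * n) = (of_int 1 :: real)"
    by simp
  then have "2 * n = 1"
    by (simp only: of_int_eq_iff)
  then show False
    by presburger
qed

section \<open>Membership in the saturation and in Q\<close>

text \<open>Two different preimages of \<open>f\<close> are used: \<open>z_star\<close> is
  nonnegative but half-integral, the table for (3, 1, 1) is integral but has a negative
  entry.\<close>

lemma vlach_plus_in_saturation:
  assumes "\<forall>c. x $ c \<in> \<nat>"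
  shows "vlach_hole + transport_mat *v x \<in> saturation_of transport_mat"
proof -
  have "0 \<le> z_star $ c" for c
  proof -
    have "\<forall>i j k. 0 \<le> z_star $ (i, j, k)"
      by (simp add: forall_3 forall_4 forall_6 z_star_def z_blocks_nth vector_4)
    then show ?thesis by (cases c) auto
  qed
  moreover have "0 \<le> x $ c" for c
    using assms by (blast intro: Nats_nonneg)
  ultimately have "\<forall>c. 0 \<le> (z_star + x) $ c"
    by (simp add: add_nonneg_nonneg)
  moreover have "vlach_hole + transport_mat *v x = transport_mat *v (z_star + x)"
    by (simp add: matrix_vector_right_distrib transport_mat_z_star)
  ultimately have cone: "vlach_hole + transport_mat *v x \<in> {transport_mat *v l | l. \<forall>c. 0 \<le> l $ c}"
    by blast
  obtain y where y: "\<forall>c. y $ c + of_bool (c = (3, 1, 1)) \<in> \<nat>"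
    and Ay: "transport_mat *v y = vlach_hole"
    using fillable_311 unfolding fillable_def by blast
  have "y $ c \<in> \<int>" for c
  proof -
    have "y $ c + of_bool (c = (3, 1, 1)) \<in> \<int>"
      using y Nats_subset_Ints by blast
    then have "y $ c + of_bool (c = (3, 1, 1)) - of_bool (c = (3, 1, 1)) \<in> \<int>"
      by (rule Ints_diff) simp
    then show ?thesis by simp
  qed
  then have "\<forall>c. (y + x) $ c \<in> \<int>"
    unfolding vector_add_component using assms Nats_subset_Ints by (blast intro: Ints_add)
  moreover have "vlach_hole + transport_mat *v x = transport_mat *v (y + x)"
    by (simp add: matrix_vector_right_distrib Ay)
  ultimately have "vlach_hole + transport_mat *v x \<in> {transport_mat *v l | l. \<forall>c. l $ c \<in> \<int>}"
    by blast
  with cone show ?thesis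
    by (simp add: saturation_of_def)
qed

text \<open>One copy of column \<open>c\<close> is taken from \<open>m\<close> to compensate the
  possible -1 at \<open>c\<close> in the table \<open>y\<close>.\<close>

lemma vlach_plus_off_support_in_semigroup:
  assumes nat: "\<forall>d. m $ d \<in> \<nat>" and "m $ c \<noteq> 0" "\<not> 0 < z_star $ c"
  shows "vlach_hole + transport_mat *v m \<in> semigroup_of transport_mat"
proof -
  obtain y where y: "\<forall>d. y $ d + of_bool (d = c) \<in> \<nat>" and Ay: "transport_mat *v y = vlach_hole"
    using fillable_off_support[OF assms(3)] unfolding fillable_def by blast
  have "m $ d - of_bool (d = c) \<in> \<nat>" for d
  proof -
    obtain n where n: "m $ d = of_nat n"
      using nat Nats_cases by blast
    show ?thesis
    proof (cases "d = c")
      case True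
      then have "m $ d - of_bool (d = c) = of_nat (n - 1)"
        using n assms(2) by (simp add: of_nat_diff)
      then show ?thesis by simp
    qed (simp add: n)
  qed
  then have "(y $ d + of_bool (d = c)) + (m $ d - of_bool (d = c)) \<in> \<nat>" for d
    using y by (blast intro: Nats_add)
  then have "\<forall>d. (y + m) $ d \<in> \<nat>"
    by simp
  moreover have "vlach_hole + transport_mat *v m = transport_mat *v (y + m)"
    by (simp add: matrix_vector_right_distrib Ay)
  ultimately show ?thesis
    unfolding semigroup_of_def by blast
qed

section \<open>The holes in f + Q and their infinitude\<close>

theorem mainTheorem4:
  shows "holes_of transport_mat \<inter> {vlach_hole + q | q. q \<in> semigroup_of transport_mat}
           = {vlach_hole + transport_submat *v l | l. \<forall>c. l $ c \<in> \<nat>}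
       \<and> infinite (holes_of transport_mat \<inter> {vlach_hole + q | q. q \<in> semigroup_of transport_mat})"
  (is "?H = ?S \<and> _")
proof -
  have eq: "?H = ?S"
    unfolding submat_semigroup_eq
  proof (intro subset_antisym subsetI)
    fix h assume "h \<in> ?H"
    then obtain m where "\<forall>c. m $ c \<in> \<nat>" "h = vlach_hole + transport_mat *v m"
      "h \<notin> semigroup_of transport_mat"
      unfolding holes_of_def semigroup_of_def by blast
    \<comment> \<open>By contraposition: a nonzero entry of \<open>m\<close> off the support would
      put \<open>h\<close> into Q.\<close>
    then show "h \<in> {vlach_hole + transport_mat *v x | x.
        (\<forall>c. x $ c \<in> \<nat>) \<and> (\<forall>c. \<not> 0 < z_star $ c \<longrightarrow> x $ c = 0)}"
      using vlach_plus_off_support_in_semigroup by (intro CollectI exI[of _ m]) blast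
  next
    fix h assume "h \<in> {vlach_hole + transport_mat *v x | x.
        (\<forall>c. x $ c \<in> \<nat>) \<and> (\<forall>c. \<not> 0 < z_star $ c \<longrightarrow> x $ c = 0)}"
    then obtain x where "\<forall>c. x $ c \<in> \<nat>" "\<forall>c. \<not> 0 < z_star $ c \<longrightarrow> x $ c = 0"
      "h = vlach_hole + transport_mat *v x"
      by blast
    moreover from this have "transport_mat *v x \<in> semigroup_of transport_mat"
      unfolding semigroup_of_def by blast
    ultimately show "h \<in> ?H"
      using vlach_plus_in_saturation[of x] supported_not_in_semigroup[of x]
      unfolding holes_of_def by blast
  qed
  \<comment> \<open>Multiples of a single support column are added to \<open>f\<close>; the margin
    \<open>w_row 1 1\<close> recovers n.\<close>
  define h where "h n = vlach_hole + transport_mat *v axis (1, 1, 1) (of_nat n)" for n :: nat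
  have "h n $ w_row 1 1 = 1 + of_nat n" for n
    by (simp add: h_def transport_mat_mult vlach_hole_def w_margin_nth axis_def sum_6)
  then have "inj h"
    by (intro injI) (metis add_left_cancel of_nat_eq_iff)
  moreover have "range h \<subseteq> ?S"
    unfolding submat_semigroup_eq
  proof clarify
    fix n :: nat
    have "0 < z_star $ (1, 1, 1)"
      by (simp add: z_star_def z_blocks_nth vector_4)
    then show "\<exists>x. h n = vlach_hole + transport_mat *v x \<and>
        (\<forall>c. x $ c \<in> \<nat>) \<and> (\<forall>c. \<not> 0 < z_star $ c \<longrightarrow> x $ c = 0)"
      by (intro exI[of _ "axis (1, 1, 1) (of_nat n)"]) (auto simp: h_def axis_def)
  qed
  ultimately have "infinite ?S"
    using range_inj_infinite infinite_super by blast
  then show ?thesis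
    unfolding eq by simp
qed

end
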